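(* For each $n$ there exists a prefix normal binary word $\tilde w$ of length $n$ such that the number of binary words of length $n$ whose prefix normal form is $\tilde w$ is $2^{n-O(\sqrt{n\log n})}$.
   Context: For a binary word $w=w_1\dots w_n\in\{0,1\}^n$ and $1\le j\le k\le n$, let $w[j,k]=w_j\dots w_k$ and let $|u|_1$ be the number of 1s in a binary word $u$. The profile of $w$ is $f_w(k)=\max_{0\le j\le n-k}|w[j+1,j+k]|_1$ for $0\le k\le n$. The word $w$ is prefix normal if $|w[1,k]|_1\ge|w[j+1,j+k]|_1$ for all $0\le k\le n$ and $0\le j\le n-k$. The prefix normal form of $w$ is the unique binary word $\tilde w$ of length $n$ with $|\tilde w[1,k]|_1=f_w(k)$ for all $0\le k\le n$ (well defined since $f_w(k)\le f_w(k+1)\le f_w(k)+1$); it is prefix normal. *)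

theory Defs
  imports Complex_Main "HOL-Library.Landau_Symbols"
begin

text \<open>Binary words are lists over \<^typ>\<open>bool\<close>, with \<^term>\<open>True\<close> standing for the letter 1.\<close>

type_synonym word = "bool list"

definition ones :: "word \<Rightarrow> nat" where
  "ones w = count_list w True"

text \<open>\<open>factor w j k\<close> is \<open>w[j,k]\<close>, with letters numbered from 1 and both ends included; in
  particular \<open>w[j+1,j]\<close> is the empty word.\<close>

definition factor :: "word \<Rightarrow> nat \<Rightarrow> nat \<Rightarrow> word" where
  "factor w j k = take (k + 1 - j) (drop (j - 1) w)"

text \<open>Only used for \<open>k \<le> length w\<close>.\<close>

definition profile :: "word \<Rightarrow> nat \<Rightarrow> nat" where
  "profile w k = Max ((\<lambda>j. ones (factor w (j + 1) (j + k))) ` {0..length w - k})"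

definition prefix_normal :: "word \<Rightarrow> bool" where
  "prefix_normal w \<longleftrightarrow>
     (\<forall>k\<le>length w. \<forall>j\<le>length w - k. ones (factor w 1 k) \<ge> ones (factor w (j + 1) (j + k)))"

definition is_prefix_normal_form :: "word \<Rightarrow> word \<Rightarrow> bool" where
  "is_prefix_normal_form w u \<longleftrightarrow>
     length u = length w \<and> (\<forall>k\<le>length w. ones (factor u 1 k) = profile w k)"

definition prefix_normal_form :: "word \<Rightarrow> word" where
  "prefix_normal_form w = (THE u. is_prefix_normal_form w u)"

text \<open>The description in \<^const>\<open>prefix_normal_form\<close> is proper.\<close>

lemma ones_append: "ones (u @ v) = ones u + ones v"
  by (simp add: ones_def)

lemma factor_prefix: "factor w 1 k = take k w"
  by (simp add: factor_def)

lemma factor_shift: "factor w (j + 1) (j + k) = take k (drop j w)"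
  by (simp add: factor_def)

lemma ones_take_Suc:
  assumes "k < length u"
  shows "ones (take (Suc k) u) = ones (take k u) + (if u ! k then 1 else 0)"
  using assms by (simp add: take_Suc_conv_app_nth ones_append) (simp add: ones_def)

lemma profile_ge: "j \<le> length w - k \<Longrightarrow> ones (take k (drop j w)) \<le> profile w k"
  unfolding profile_def factor_shift by (intro Max_ge) auto

lemma profile_attained: "\<exists>j\<le>length w - k. profile w k = ones (take k (drop j w))"
proof -
  have "profile w k \<in> (\<lambda>j. ones (factor w (j + 1) (j + k))) ` {0..length w - k}"
    unfolding profile_def by (intro Max_in) auto
  then show ?thesis by (auto simp only: factor_shift atLeastAtMost_iff)
qed

lemma profile_0: "profile w 0 = 0"
  using profile_attained[of w 0] by (auto simp: ones_def)

lemma profile_Suc_le: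
  assumes "k < length w"
  shows "profile w (Suc k) \<le> profile w k + 1"
proof -
  obtain j where j: "j \<le> length w - Suc k" "profile w (Suc k) = ones (take (Suc k) (drop j w))"
    using profile_attained by blast
  have "k < length (drop j w)" using j(1) assms by simp
  then have "profile w (Suc k) \<le> ones (take k (drop j w)) + 1"
    using ones_take_Suc[of k "drop j w"] j(2) by simp
  moreover have "ones (take k (drop j w)) \<le> profile w k"
    using j(1) by (intro profile_ge) simp
  ultimately show ?thesis by simp
qed

lemma profile_le_Suc:
  assumes "k < length w"
  shows "profile w k \<le> profile w (Suc k)"
proof -
  obtain j where j: "j \<le> length w - k" "profile w k = ones (take k (drop j w))"
    using profile_attained by blast
  show ?thesis
  proof (cases "j \<le> length w - Suc k")
    case True
    have "k < length (drop j w)" using True assms by simp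
    then have "profile w k \<le> ones (take (Suc k) (drop j w))"
      using ones_take_Suc[of k "drop j w"] j(2) by simp
    with profile_ge[OF True] show ?thesis by simp
  next
    case False
    define i where "i = length w - Suc k"
    have ji: "j = Suc i" and "i < length w" using False j(1) assms by (auto simp: i_def)
    then have "take (Suc k) (drop i w) = [w ! i] @ take k (drop j w)"
      by (simp add: Cons_nth_drop_Suc[symmetric])
    then have "profile w k \<le> ones (take (Suc k) (drop i w))"
      using j(2) by (simp add: ones_def)
    also have "\<dots> \<le> profile w (Suc k)" by (intro profile_ge) (simp add: i_def)
    finally show ?thesis .
  qed
qed

lemma ex1_prefix_normal_form: "\<exists>!u. is_prefix_normal_form w u"
proof (rule ex_ex1I)
  define u where "u = map (\<lambda>k. profile w (Suc k) > profile w k) [0..<length w]"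
  have "ones (take k u) = profile w k" if "k \<le> length w" for k
    using that
  proof (induction k)
    case 0
    show ?case by (simp add: ones_def profile_0)
  next
    case (Suc k)
    then have "k < length w" by simp
    then show ?case
      using Suc ones_take_Suc[of k u] profile_Suc_le[of k w] profile_le_Suc[of k w]
      by (auto simp: u_def)
  qed
  then show "\<exists>u. is_prefix_normal_form w u"
    unfolding is_prefix_normal_form_def factor_prefix by (intro exI[of _ u]) (simp add: u_def)
next
  fix u v
  assume "is_prefix_normal_form w u" "is_prefix_normal_form w v"
  then have len: "length u = length w" "length v = length w"
    and eq: "\<And>k. k \<le> length w \<Longrightarrow> ones (take k u) = ones (take k v)"
    unfolding is_prefix_normal_form_def factor_prefix by auto
  show "u = v"
  proof (rule nth_equalityI)
    fix k assume "k < length u"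
    then show "u ! k = v ! k"
      using eq[of k] eq[of "Suc k"] ones_take_Suc[of k u] ones_take_Suc[of k v] len
      by (auto split: if_splits)
  qed (simp add: len)
qed

lemma is_prefix_normal_form_prefix_normal_form:
  "is_prefix_normal_form w (prefix_normal_form w)"
  unfolding prefix_normal_form_def by (rule theI') (rule ex1_prefix_normal_form)

end

theory Submission
  imports Defs "HOL-Real_Asymp.Real_Asymp"
begin

text \<open>Call the number of ones minus the number of zeros of a word its height. Consider the words
  \<open>\<dots>0101 1\<^sup>L b\<^sub>1 \<dots> b\<^sub>t\<close> whose blocks \<open>b\<^sub>i\<close> have even length \<open>L\<close>, height \<open>0\<close> and no prefix of positive
  height. The heights of their prefixes span an interval of length \<open>L + 1\<close>, which bounds the number of
  ones of every factor. Since the number of ones of a factor of length \<open>k\<close> is determined by its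
  height, which has the parity of \<open>k\<close>, the bound is attained for every \<open>k \<ge> L\<close>: extend \<open>1\<^sup>L\<close> to the
  right by whole blocks and to the left by a suffix of the alternating part. So all these words have
  the same prefix normal form. By rotation there are at least \<open>2\<^sup>L / L\<^sup>2\<close> blocks, and
  \<open>L \<approx> 2 \<surd>(n ln n)\<close> balances the loss \<open>O(L)\<close> in the fixed part against the loss \<open>O((n / L) log L)\<close> in
  the blocks.\<close>

section \<open>Prefix normal forms\<close>

lemma ones_le_length: "ones v \<le> length v"
  by (simp add: ones_def count_le_length)

lemma ones_replicate_True [simp]: "ones (replicate m True) = m"
  by (induction m) (auto simp: ones_def)

text \<open>A best factor of length \<open>j + k\<close> splits into factors of lengths
  \<open>j\<close> and \<open>k\<close>. This is what makes normal forms prefix normal.\<close>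

lemma profile_subadditive:
  assumes "j + k \<le> length w"
  shows "profile w (j + k) \<le> profile w j + profile w k"
proof -
  obtain i where i: "i \<le> length w - (j + k)" "profile w (j + k) = ones (take (j + k) (drop i w))"
    using profile_attained by blast
  have "take (j + k) (drop i w) = take j (drop i w) @ take k (drop (i + j) w)"
    by (simp add: take_add add.commute)
  moreover have "ones (take j (drop i w)) \<le> profile w j"
    using i(1) by (intro profile_ge) simp
  moreover have "ones (take k (drop (i + j) w)) \<le> profile w k"
    using i(1) assms by (intro profile_ge) simp
  ultimately show ?thesis using i(2) by (simp add: ones_append)
qed

lemma length_prefix_normal_form: "length (prefix_normal_form w) = length w"
  using is_prefix_normal_form_prefix_normal_form[of w] by (simp add: is_prefix_normal_form_def)

lemma prefix_normal_prefix_normal_form: "prefix_normal (prefix_normal_form w)"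
proof -
  define u where "u = prefix_normal_form w"
  have len: "length u = length w" by (simp add: u_def length_prefix_normal_form)
  have eq: "ones (take k u) = profile w k" if "k \<le> length w" for k
    using is_prefix_normal_form_prefix_normal_form[of w] that
    by (simp only: is_prefix_normal_form_def u_def factor_prefix)
  \<comment> \<open>The factor count is \<open>profile w (j + k) - profile w j\<close>, so
    subadditivity bounds it by \<open>profile w k\<close>.\<close>
  have "ones (take k (drop j u)) \<le> ones (take k u)" if "k \<le> length u" "j \<le> length u - k" for k j
  proof -
    have "j + k \<le> length w" using that len by simp
    have "ones (take (j + k) u) = ones (take j u) + ones (take k (drop j u))"
      by (simp add: take_add ones_append)
    then show ?thesis
      using profile_subadditive[OF \<open>j + k \<le> length w\<close>] eq \<open>j + k \<le> length w\<close> by simp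
  qed
  then show ?thesis
    unfolding prefix_normal_def factor_shift factor_prefix u_def by simp
qed

lemma prefix_normal_form_cong:
  assumes "length v = length w" "\<And>k. k \<le> length w \<Longrightarrow> profile v k = profile w k"
  shows "prefix_normal_form v = prefix_normal_form w"
proof -
  have "is_prefix_normal_form v = is_prefix_normal_form w"
    using assms by (simp add: is_prefix_normal_form_def fun_eq_iff)
  then show ?thesis by (simp add: prefix_normal_form_def)
qed

section \<open>Height and Dyck words\<close>

definition height :: "word \<Rightarrow> int" where
  "height v = 2 * int (ones v) - int (length v)"

lemma height_Nil [simp]: "height [] = 0"
  by (simp add: height_def ones_def)

lemma height_append [simp]: "height (u @ v) = height u + height v"
  by (simp add: height_def ones_append)

lemma height_replicate_True [simp]: "height (replicate m True) = int m"
  by (simp add: height_def)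

lemma height_ge: "- int (length v) \<le> height v"
  by (simp add: height_def)

lemma height_take_drop: "height (take k (drop j w)) = height (take (j + k) w) - height (take j w)"
  by (simp add: take_add)

text \<open>Dyck paths reflected below the axis. The index \<open>i\<close> may be unbounded because
  \<open>take\<close> saturates.\<close>

definition dyck :: "nat \<Rightarrow> word set" where
  "dyck L = {v. length v = L \<and> height v = 0 \<and> (\<forall>i. height (take i v) \<le> 0)}"

lemma card_words_ones: "card {v. length v = n \<and> ones v = k} = n choose k"
proof (induction n arbitrary: k)
  case 0
  have "{v. length v = 0 \<and> ones v = k} = (if k = 0 then {[]} else {})"
    by (auto simp: ones_def)
  then show ?case by (simp add: binomial_eq_0)
next
  case (Suc n)
  define S where "S k = {v. length v = n \<and> ones v = k}" for k
  have fin: "finite (S k)" for k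
    unfolding S_def by (rule finite_subset[OF _ finite_lists_length_eq[of UNIV n]]) auto
  have S: "card (S k) = n choose k" for k using Suc.IH by (simp add: S_def)
  have split: "{v. length v = Suc n \<and> ones v = k} =
      Cons False ` S k \<union> (if k = 0 then {} else Cons True ` S (k - 1))" (is "?L = ?R")
  proof (rule set_eqI)
    fix v show "v \<in> ?L \<longleftrightarrow> v \<in> ?R"
      by (cases v; cases "hd v") (auto simp: S_def ones_def)
  qed
  show ?case
  proof (cases k)
    case 0
    then show ?thesis unfolding split by (simp add: card_image S)
  next
    case (Suc l)
    have "card (Cons False ` S k \<union> Cons True ` S l) = card (S k) + card (S l)"
      by (subst card_Un_disjoint) (auto simp: fin card_image)
    then show ?thesis unfolding split by (simp add: S Suc)
  qed
qed

text \<open>Cut a word of height \<open>0\<close> where the height is largest.\<close>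

lemma balanced_eq_rotate_dyck:
  assumes "height w = 0" "length w > 0"
  shows "\<exists>i<length w. \<exists>v\<in>dyck (length w). w = rotate i v"
proof -
  define H where "H j = height (take j w)" for j
  define L where "L = length w"
  have L: "L > 0" using assms by (simp add: L_def)
  \<comment> \<open>The cut point is sought in \<open>{1..L}\<close> rather than
    \<open>{0..L}\<close>, so that the rotation by \<open>L - i\<close> stays below
    \<open>L\<close>.\<close>
  have "Max (H ` {1..L}) \<in> H ` {1..L}" using L by (intro Max_in) auto
  then obtain i where i: "1 \<le> i" "i \<le> L" "H i = Max (H ` {1..L})" by auto
  have H0: "H 0 = 0" "H L = 0" using assms by (simp_all add: H_def L_def)
  have max: "H j \<le> H i" for j
  proof -
    have in_range: "H l \<le> H i" if "l \<in> {1..L}" for l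
      unfolding i(3) using that by (intro Max_ge) auto
    consider "j \<in> {1..L}" | "j = 0" | "j > L" by force
    then show ?thesis
    proof cases
      case 1
      then show ?thesis by (rule in_range)
    next
      case 2
      then show ?thesis using H0 L in_range[of L] by simp
    next
      case 3
      then have "H j = H L" by (simp add: H_def L_def)
      then show ?thesis using L in_range[of L] by simp
    qed
  qed
  define v where "v = drop i w @ take i w"
  have lenv: "length v = L" using i by (simp add: v_def L_def)
  have hd: "height (take t (drop i w)) = H (i + t) - H i" for t
    by (simp add: H_def height_take_drop)
  have "height v = height (take i w @ drop i w)" by (simp add: v_def del: append_take_drop_id)
  then have hv: "height v = 0" using assms by simp
  have "height (take t v) \<le> 0" for t
  proof (cases "t \<le> L - i")
    case True
    then have "take t v = take t (drop i w)" by (simp add: v_def L_def)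
    then show ?thesis using hd max by simp
  next
    case False
    define s where "s = min (t - (L - i)) i"
    have "take t v = take t (drop i w) @ take s w"
      by (simp add: v_def L_def s_def)
    \<comment> \<open>Once the prefix of \<open>v\<close> wraps around, its height is
      \<open>0 - H i + H s\<close>, again at most 0 by maximality of \<open>H i\<close>.\<close>
    moreover have "H (i + t) = 0" using False H0 by (simp add: H_def L_def)
    ultimately show ?thesis using hd[of t] max[of s] by (simp add: H_def)
  qed
  then have "v \<in> dyck L" using lenv hv by (simp add: dyck_def)
  moreover have "w = rotate (L - i) v"
    using rotate_append[of "drop i w" "take i w"] by (simp add: v_def L_def)
  moreover have "L - i < L" using i by simp
  ultimately show ?thesis unfolding L_def by blast
qed

lemma finite_dyck: "finite (dyck L)"
  by (rule finite_subset[OF _ finite_lists_length_eq[of UNIV L]]) (auto simp: dyck_def)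

text \<open>One factor \<open>L\<close> counts the rotations that reach all balanced words from
  \<open>dyck L\<close>; the other comes from the bound \<open>4 ^ l / (2 * l)\<close> for the
  central binomial coefficient.\<close>

lemma card_dyck_ge:
  assumes "even L" "L > 0"
  shows "2 ^ L \<le> card (dyck L) * L\<^sup>2"
proof -
  obtain l where l: "L = 2 * l" using assms by blast
  let ?S = "{v. length v = L \<and> ones v = l}"
  have "?S \<subseteq> (\<lambda>(i, v). rotate i v) ` ({..<L} \<times> dyck L)"
  proof
    fix w assume "w \<in> ?S"
    then have "length w = L" "height w = 0" by (auto simp: height_def l)
    then show "w \<in> (\<lambda>(i, v). rotate i v) ` ({..<L} \<times> dyck L)"
      using balanced_eq_rotate_dyck[of w] assms by fastforce
  qed
  then have "card ?S \<le> card ((\<lambda>(i, v). rotate i v) ` ({..<L} \<times> dyck L))"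
    by (intro card_mono) (auto simp: finite_dyck)
  also have "\<dots> \<le> L * card (dyck L)"
    using card_image_le[of "{..<L} \<times> dyck L" "\<lambda>(i, v). rotate i v"]
    by (simp add: finite_dyck card_cartesian_product)
  finally have le: "2 * l choose l \<le> L * card (dyck L)"
    by (simp add: card_words_ones l)
  have "4 ^ l / (2 * real l) \<le> real (2 * l choose l)"
    using assms l by (intro central_binomial_lower_bound) simp
  then have "real (4 ^ l) \<le> real (L * (2 * l choose l))"
    using assms l by (simp add: field_simps)
  then have "2 ^ L \<le> L * (2 * l choose l)"
    by (simp only: of_nat_le_iff l power_mult) simp
  also have "\<dots> \<le> L * (L * card (dyck L))" using le by (rule mult_le_mono2)
  finally show ?thesis by (simp add: power2_eq_square mult_ac)
qed

text \<open>Complete blocks contribute 0, so only the block that is cut matters; its prefix has at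
  most \<open>L\<close> letters.\<close>

lemma height_take_concat_dyck:
  assumes "set bs \<subseteq> dyck L"
  shows "height (take i (concat bs)) \<in> {- int L..0}"
  using assms
proof (induction bs arbitrary: i)
  case Nil
  then show ?case by simp
next
  case (Cons b bs)
  have b: "length b = L" "height b = 0" "height (take i b) \<le> 0"
    using Cons.prems by (auto simp: dyck_def)
  show ?case
  proof (cases "i \<le> L")
    case True
    then show ?thesis using b height_ge[of "take i b"] by simp
  next
    case False
    then show ?thesis using b Cons by simp
  qed
qed

lemma height_take_concat_dyck_mult:
  assumes "set bs \<subseteq> dyck L" "s \<le> length bs"
  shows "height (take (s * L) (concat bs)) = 0"
  using assms
proof (induction bs arbitrary: s)
  case Nil
  then show ?case by simp
next
  case (Cons b bs)
  then show ?case by (cases s) (auto simp: dyck_def)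
qed

lemma length_concat_dyck: "set bs \<subseteq> dyck L \<Longrightarrow> length (concat bs) = length bs * L"
  by (induction bs) (auto simp: dyck_def)

lemma inj_on_concat_dyck: "inj_on concat {bs. set bs \<subseteq> dyck L \<and> length bs = t}"
proof (rule inj_onI)
  fix xs ys
  assume xy: "xs \<in> {bs. set bs \<subseteq> dyck L \<and> length bs = t}"
    "ys \<in> {bs. set bs \<subseteq> dyck L \<and> length bs = t}" "concat xs = concat ys"
  have "length x = length y" if "(x, y) \<in> set (zip xs ys)" for x y
    using xy set_zip_leftD[OF that] set_zip_rightD[OF that] by (auto simp: dyck_def)
  then show "xs = ys" using xy by (intro concat_injective) auto
qed

section \<open>Words with a common profile\<close>

text \<open>Growing to the left keeps the last letter 1 and makes every suffix again an
  \<open>alt\<close>, of height 0 or 1.\<close>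

fun alt :: "nat \<Rightarrow> word" where
  "alt 0 = []"
| "alt (Suc a) = even a # alt a"

lemma length_alt [simp]: "length (alt a) = a"
  by (induction a) auto

lemma height_alt: "height (alt a) = int (a mod 2)"
proof (induction a)
  case (Suc a)
  then show ?case by (cases "even a") (auto simp: height_def ones_def mod_Suc odd_iff_mod_2_eq_one)
qed simp

lemma drop_alt: "drop i (alt a) = alt (a - i)"
proof (induction a arbitrary: i)
  case (Suc a)
  then show ?case by (cases i) auto
qed simp

lemma height_take_alt: "height (take i (alt a)) = int (a mod 2) - int ((a - i) mod 2)"
proof -
  have "height (alt a) = height (take i (alt a)) + height (drop i (alt a))"
    by (metis append_take_drop_id height_append)
  then show ?thesis by (simp add: height_alt drop_alt)
qed

locale padded_dyck_word =
  fixes L a :: nat and bs :: "word list" and w :: word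
  assumes even_L: "even L" and L_pos: "L > 0" and a_ge: "L \<le> a" and dyck_bs: "set bs \<subseteq> dyck L"
    and w_eq: "w = alt a @ replicate L True @ concat bs"
begin

lemma length_w: "length w = a + L + length bs * L"
  by (simp add: w_eq length_concat_dyck[OF dyck_bs])

text \<open>The alternating part moves between two adjacent heights and ends at the upper one; the
  run of ones climbs by \<open>L\<close>; the blocks descend from there by at most
  \<open>L\<close>.\<close>

lemma height_take_w: "height (take i w) \<in> {int (a mod 2) - 1..int (a mod 2) + int L}"
proof -
  have eq: "height (take i w) = int (a mod 2) - int ((a - i) mod 2) + int (min (i - a) L)
      + height (take (i - a - L) (concat bs))"
    by (simp add: w_eq height_take_alt min.commute)
  have c: "height (take (i - a - L) (concat bs)) \<in> {- int L..0}"
    by (rule height_take_concat_dyck[OF dyck_bs])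
  consider "i \<le> a" | "a < i" "i \<le> a + L" | "a + L < i" by linarith
  then show ?thesis
  proof cases
    case 1
    have "(a - i) mod 2 \<le> 1" by simp
    then show ?thesis using 1 eq by simp
  next
    case 2
    then show ?thesis using eq by simp
  next
    case 3
    then show ?thesis using eq c by simp
  qed
qed

text \<open>The value depends on \<open>k\<close> and \<open>L\<close> only, not on
  \<open>bs\<close>; hence the common normal form. Above, a factor's height is a difference of two
  prefix heights, so at most \<open>L + 1\<close>.\<close>

lemma profile_w:
  assumes k: "k \<le> length w"
  shows "profile w k = (if k \<le> L then k else (k + L + 1) div 2)"
proof (rule antisym)
  obtain j where j: "profile w k = ones (take k (drop j w))" "j \<le> length w - k"
    using profile_attained by blast
  have len: "length (take k (drop j w)) = k" using j k by simp
  have "height (take k (drop j w)) \<le> int L + 1"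
    using height_take_w[of j] height_take_w[of "j + k"] by (simp add: height_take_drop)
  then have "2 * ones (take k (drop j w)) \<le> k + L + 1"
    using len by (simp add: height_def)
  then show "profile w k \<le> (if k \<le> L then k else (k + L + 1) div 2)"
    using j(1) len ones_le_length[of "take k (drop j w)"] by auto
next
  show "(if k \<le> L then k else (k + L + 1) div 2) \<le> profile w k"
  proof (cases "k \<le> L")
    case True
    have "take k (drop a w) = replicate k True" using True by (simp add: w_eq min_def)
    then have "ones (take k (drop a w)) = k" by simp
    moreover have "ones (take k (drop a w)) \<le> profile w k"
      using True by (intro profile_ge) (simp add: length_w)
    ultimately show ?thesis using True by simp
  next
    case False
    \<comment> \<open>Use as many whole blocks as fit on the right of the ones and put the remaining
      \<open>r\<close> letters on the left: \<open>r < L\<close> if the blocks suffice, otherwise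
      all blocks are used and \<open>r\<close> is bounded by
      \<open>k \<le> length w\<close>.\<close>
    obtain s r where sr: "k = r + L + s * L" "s \<le> length bs" "r \<le> a"
    proof (cases "k - L \<le> length bs * L")
      case True
      show ?thesis
      proof (rule that)
        show "k = (k - L) mod L + L + (k - L) div L * L" using False by simp
        show "(k - L) div L \<le> length bs"
          using True L_pos by (simp add: div_le_mono[THEN order_trans, of _ "length bs * L"])
        show "(k - L) mod L \<le> a"
          using a_ge L_pos mod_less_divisor[of L "k - L"] by linarith
      qed
    next
      case False
      show ?thesis
        by (rule that[of "k - L - length bs * L" "length bs"])
          (use False k length_w in auto)
    qed
    define x where "x = take k (drop (a - r) w)"
    have "x = alt r @ replicate L True @ take (s * L) (concat bs)"
      using sr by (simp add: x_def w_eq drop_alt)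
    then have hx: "height x = int (r mod 2) + int L"
      using height_take_concat_dyck_mult[OF dyck_bs sr(2)] by (simp add: height_alt)
    have "s * L \<le> length bs * L" using sr(2) by simp
    then have *: "a - r \<le> length w - k"
      using sr(1,3) length_w by linarith
    then have "length x = k" using k sr by (simp add: x_def)
    then have two: "2 * ones x = k + L + r mod 2" using hx by (simp add: height_def)
    \<comment> \<open>As \<open>L\<close> is even, \<open>r mod 2\<close> is exactly the correction
      that rounding down \<open>(k + L + 1) / 2\<close> makes.\<close>
    have "even (k + L) = even r" using sr(1) even_L by simp
    then have "(k + L + 1) div 2 = ones x"
      using two by (cases "even r") (auto simp: odd_iff_mod_2_eq_one elim!: evenE)
    then show ?thesis using profile_ge[OF *] False by (simp add: x_def)
  qed
qed

end

lemma prefix_normal_form_class_ge: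
  assumes "even L" "L > 0" "2 * L \<le> n"
  shows "\<exists>w. length w = n \<and> prefix_normal w \<and>
    card (dyck L) ^ (n div L - 2) \<le> card {v. length v = n \<and> prefix_normal_form v = w}"
proof -
  \<comment> \<open>Two of the \<open>n div L\<close> stretches of length \<open>L\<close> go to the
    run of ones and to the alternating part, which also absorbs the remainder
    \<open>n mod L\<close>.\<close>
  define t where "t = n div L - 2"
  define a where "a = L + n mod L"
  have "2 \<le> n div L" using assms div_le_mono[OF assms(3), of L] by simp
  then have "n div L = t + 2" by (simp add: t_def)
  then have n: "n = a + L + t * L"
    using div_mult_mod_eq[of n L] by (simp add: a_def algebra_simps)
  define word where "word bs = alt a @ replicate L True @ concat bs" for bs
  define B where "B = {bs. set bs \<subseteq> dyck L \<and> length bs = t}"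
  have loc: "padded_dyck_word L a bs (word bs)" if "bs \<in> B" for bs
    using that assms by unfold_locales (auto simp: B_def word_def a_def)
  have len: "length (word bs) = n" if "bs \<in> B" for bs
    using padded_dyck_word.length_w[OF loc[OF that]] that n by (simp add: B_def)
  \<comment> \<open>A block exists, so some word of the family can serve as reference for the common
    normal form.\<close>
  have "card (dyck L) \<noteq> 0" using card_dyck_ge[OF assms(1,2)] by (intro notI) simp
  then obtain b where b: "b \<in> dyck L" by fastforce
  define b0 where "b0 = replicate t b"
  have b0: "b0 \<in> B" using b by (auto simp: b0_def B_def)
  define u where "u = prefix_normal_form (word b0)"
  have "prefix_normal_form (word bs) = u" if "bs \<in> B" for bs
    unfolding u_def
    using len[OF that] len[OF b0] padded_dyck_word.profile_w[OF loc[OF that]]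
      padded_dyck_word.profile_w[OF loc[OF b0]]
    by (intro prefix_normal_form_cong) auto
  then have sub: "word ` B \<subseteq> {v. length v = n \<and> prefix_normal_form v = u}"
    using len by auto
  have "inj_on word B"
    using inj_on_concat_dyck[of L t] by (auto simp: inj_on_def word_def B_def)
  then have "card (word ` B) = card (dyck L) ^ t"
    by (simp add: card_image B_def card_lists_length_eq[OF finite_dyck])
  moreover have "card (word ` B) \<le> card {v. length v = n \<and> prefix_normal_form v = u}"
    by (rule card_mono[OF _ sub], rule finite_subset[OF _ finite_lists_length_eq[of UNIV n]]) auto
  ultimately show ?thesis
    using len[OF b0] prefix_normal_prefix_normal_form length_prefix_normal_form
    by (intro exI[of _ u]) (simp add: u_def t_def)
qed

section \<open>The choice of the block length\<close>

text \<open>The fixed part has fewer than \<open>3 * L\<close> letters, and each of at most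
  \<open>n / L\<close> blocks loses \<open>2 * log 2 L\<close> against free choice.\<close>

lemma prefix_normal_form_class_log_ge:
  assumes "even L" "L > 0" "2 * L \<le> n"
  shows "\<exists>w. length w = n \<and> prefix_normal w \<and>
    card {v. length v = n \<and> prefix_normal_form v = w} > 0 \<and>
    real n - log 2 (real (card {v. length v = n \<and> prefix_normal_form v = w}))
      \<le> 3 * real L + 2 * (real n / real L) * log 2 (real n)"
proof -
  define t where "t = n div L - 2"
  obtain w where w: "length w = n" "prefix_normal w"
    "card (dyck L) ^ t \<le> card {v. length v = n \<and> prefix_normal_form v = w}" (is "_ \<le> ?c")
    using prefix_normal_form_class_ge[OF assms] unfolding t_def by blast
  have "(2::nat) ^ (L * t) = (2 ^ L) ^ t" by (simp add: power_mult)
  also have "\<dots> \<le> (card (dyck L) * L\<^sup>2) ^ t"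
    using card_dyck_ge[OF assms(1,2)] by (rule power_mono) simp
  also have "\<dots> = card (dyck L) ^ t * L ^ (2 * t)" by (simp add: power_mult_distrib power_mult)
  also have "\<dots> \<le> ?c * L ^ (2 * t)" using w(3) by simp
  finally have le: "2 ^ (L * t) \<le> ?c * L ^ (2 * t)" .
  then have "0 < ?c * L ^ (2 * t)" by (rule less_le_trans[rotated]) simp
  then have pos: "?c > 0" by (simp only: nat_0_less_mult_iff)
  have "real (2 ^ (L * t)) \<le> real (?c * L ^ (2 * t))" using le by (rule of_nat_mono)
  then have "2 ^ (L * t) \<le> real ?c * real L ^ (2 * t)" by simp
  then have "log 2 (2 ^ (L * t)) \<le> log 2 (real ?c * real L ^ (2 * t))"
    using pos assms by (subst log_le_cancel_iff) auto
  also have "\<dots> = log 2 (real ?c) + real (2 * t) * log 2 (real L)"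
    using pos assms by (subst log_mult) (auto simp: log_nat_power)
  finally have "real (L * t) \<le> log 2 (real ?c) + real (2 * t) * log 2 (real L)"
    by (simp add: log_nat_power)
  moreover have "real n \<le> real (L * t) + 3 * real L"
  proof -
    have "2 \<le> n div L" using assms div_le_mono[OF assms(3), of L] by simp
    then have "n div L = t + 2" by (simp add: t_def)
    moreover have "n mod L < L" using assms by simp
    ultimately have "n \<le> L * t + 3 * L"
      using div_mult_mod_eq[of n L] by (simp add: algebra_simps)
    then have "real n \<le> real (L * t + 3 * L)" by (rule of_nat_mono)
    then show ?thesis by simp
  qed
  moreover have "real (2 * t) * log 2 (real L) \<le> 2 * (real n / real L) * log 2 (real n)"
  proof (rule mult_mono)
    have "real t \<le> real (n div L)" by (simp add: t_def)
    also have "\<dots> \<le> real n / real L" by (rule of_nat_div_le_of_nat)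
    finally show "real (2 * t) \<le> 2 * (real n / real L)" by simp
  qed (use assms in auto)
  ultimately have "real n - log 2 (real ?c) \<le> 3 * real L + 2 * (real n / real L) * log 2 (real n)"
    by linarith
  then show ?thesis using w pos by blast
qed

lemma prefix_normal_form_class_asymp:
  "\<forall>\<^sub>F n in sequentially. \<exists>w. length w = n \<and> prefix_normal w \<and>
    card {v. length v = n \<and> prefix_normal_form v = w} > 0 \<and>
    real n - log 2 (real (card {v. length v = n \<and> prefix_normal_form v = w}))
      \<le> 14 * sqrt (real n * ln (real n))"
proof -
  \<comment> \<open>This ensures \<open>2 * L \<le> n\<close>, since rounding up gives
    \<open>L \<le> 2 * (q + 1)\<close> for \<open>q = sqrt (n * ln n)\<close>.\<close>
  have ev1: "\<forall>\<^sub>F n in sequentially. 4 * (sqrt (real n * ln (real n)) + 1) \<le> real n"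
    by real_asymp
  have ev2: "\<forall>\<^sub>F n in sequentially. sqrt (real n * ln (real n)) \<ge> 1"
    by real_asymp
  have "ln (1 / 2) \<le> 1 / 2 - (1 :: real)" by (rule ln_le_minus_one) simp
  then have ln2: "1 / 2 \<le> ln (2 :: real)" by (simp add: ln_div)
  show ?thesis
    using ev1 ev2 eventually_gt_at_top[of 1]
  proof eventually_elim
    case (elim n)
    define q where "q = sqrt (real n * ln (real n))"
    define L where "L = 2 * nat \<lceil>q\<rceil>"
    have q: "q \<ge> 1" "4 * (q + 1) \<le> real n" using elim by (simp_all add: q_def)
    have qq: "q * q = real n * ln (real n)" using elim by (simp add: q_def)
    have L: "2 * q \<le> real L" "real L \<le> 2 * (q + 1)" using q by (simp_all add: L_def) linarith+
    have "L > 0" "2 * L \<le> n" "even L" using L q by (auto simp: L_def)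
    have "2 * (real n / real L) * log 2 (real n) \<le> 2 * (real n / (2 * q)) * log 2 (real n)"
      using L q elim by (intro mult_right_mono mult_left_mono divide_left_mono) auto
    also have "\<dots> = real n * ln (real n) / (q * ln 2)" by (simp add: log_def)
    also have "\<dots> = q / ln 2" using q by (simp flip: qq)
    also have "\<dots> \<le> q / (1 / 2)"
      using q ln2 by (intro divide_left_mono) auto
    finally have "3 * real L + 2 * (real n / real L) * log 2 (real n) \<le> 6 * (q + 1) + 2 * q"
      using L by simp
    \<comment> \<open>The constant 14 arises from \<open>8 * q + 6\<close> and
      \<open>q \<ge> 1\<close>.\<close>
    also have "\<dots> \<le> 14 * q" using q by simp
    finally have bound: "3 * real L + 2 * (real n / real L) * log 2 (real n) \<le> 14 * q" .
    obtain w where "length w = n \<and> prefix_normal w \<and>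
      card {v. length v = n \<and> prefix_normal_form v = w} > 0" and
      "real n - log 2 (real (card {v. length v = n \<and> prefix_normal_form v = w}))
        \<le> 3 * real L + 2 * (real n / real L) * log 2 (real n)"
      using prefix_normal_form_class_log_ge[OF \<open>even L\<close> \<open>L > 0\<close> \<open>2 * L \<le> n\<close>] by blast
    with bound show ?case
      unfolding q_def by (intro exI[of _ w]) linarith
  qed
qed

theorem theorem2:
  "\<exists>g :: nat \<Rightarrow> real. g \<in> O(\<lambda>n. sqrt (real n * ln (real n))) \<and>
     (\<forall>n. \<exists>w :: word. length w = n \<and> prefix_normal w \<and>
        real (card {v :: word. length v = n \<and> prefix_normal_form v = w}) = 2 powr (real n - g n))"
proof -
  define c where "c n w = card {v :: word. length v = n \<and> prefix_normal_form v = w}" for n w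
  define good where "good n w \<longleftrightarrow> length w = n \<and> prefix_normal w \<and> c n w > 0" for n w
  define short where "short n w \<longleftrightarrow>
    real n - log 2 (real (c n w)) \<le> 14 * sqrt (real n * ln (real n))" for n w
  have fin: "finite {v :: word. length v = n \<and> prefix_normal_form v = w}" for n w
    by (rule finite_subset[OF _ finite_lists_length_eq[of UNIV n]]) auto
  have "\<exists>w. good n w" for n
  proof
    let ?v = "replicate n True"
    have "?v \<in> {v. length v = n \<and> prefix_normal_form v = prefix_normal_form ?v}" by simp
    then have "c n (prefix_normal_form ?v) > 0"
      unfolding c_def using fin card_gt_0_iff by blast
    then show "good n (prefix_normal_form ?v)"
      by (simp add: good_def prefix_normal_prefix_normal_form length_prefix_normal_form)
  qed
  \<comment> \<open>The asymptotic bound holds only eventually, but a word is required for every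
    \<open>n\<close>: take one with the bound whenever it exists, and any normal form
    otherwise.\<close>
  then have "\<forall>n. \<exists>w. good n w \<and> ((\<exists>w. good n w \<and> short n w) \<longrightarrow> short n w)"
    by blast
  then obtain W where W: "\<And>n. good n (W n)" "\<And>n w. good n w \<Longrightarrow> short n w \<Longrightarrow> short n (W n)"
    by metis
  define g where "g n = real n - log 2 (real (c n (W n)))" for n
  \<comment> \<open>The Landau bound concerns the absolute value of \<open>g\<close>, so a lower
    bound is needed too; it holds because a class has at most \<open>2 ^ n\<close> words.\<close>
  have "g n \<ge> 0" for n
  proof -
    have "c n (W n) \<le> card {v :: word. set v \<subseteq> UNIV \<and> length v = n}"
      unfolding c_def by (rule card_mono[OF finite_lists_length_eq]) auto
    also have "\<dots> = 2 ^ n" by (subst card_lists_length_eq) auto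
    finally have "real (c n (W n)) \<le> real (2 ^ n)" by (rule of_nat_mono)
    then have "real (c n (W n)) \<le> 2 ^ n" by simp
    then have "log 2 (real (c n (W n))) \<le> log 2 (2 ^ n)"
      using W(1)[of n] by (subst log_le_cancel_iff) (auto simp: good_def)
    then show ?thesis by (simp add: g_def log_nat_power)
  qed
  moreover have "\<forall>\<^sub>F n in sequentially. g n \<le> 14 * sqrt (real n * ln (real n))"
    using prefix_normal_form_class_asymp
  proof eventually_elim
    case (elim n)
    then have "\<exists>w. good n w \<and> short n w" by (simp add: good_def short_def c_def)
    then show ?case using W(2) by (auto simp: g_def short_def)
  qed
  ultimately have "g \<in> O(\<lambda>n. sqrt (real n * ln (real n)))"
    by (intro bigoI[of _ 14]) (auto elim!: eventually_mono intro: order_trans[OF _ abs_ge_self]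
        simp: abs_mult)
  moreover have "real (c n (W n)) = 2 powr (real n - g n)" for n
    using W(1)[of n] by (simp add: g_def good_def)
  ultimately show ?thesis
    using W(1) unfolding good_def c_def by blast
qed

end
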